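(* Let $\mathbb{D}=\{z\in\mathbb{C}:|z|<1\}$, let $(a_n)_{n\in\mathbb{N}}$ be a sequence of points of $\mathbb{D}$ converging to a point of the boundary $\partial\mathbb{D}$, let $A=\{a_n:n\in\mathbb{N}\}$, and let $\Omega=\mathbb{D}\setminus A$. Then for every $z\in\Omega$ the Fridman invariant of $\Omega$ at $z$ with respect to the Carathéodory pseudodistance is $$h_{\Omega}^{c}(z)=\inf_{w\in A}\left|\frac{w-z}{1-\overline{z}w}\right|.$$
   Context: Carathéodory pseudodistance: for a domain $\Omega\subseteq\mathbb{C}$ and $z_1,z_2\in\Omega$, $$c_{\Omega}(z_1,z_2)=\sup\{\tanh^{-1}|\alpha| : f:\Omega\to\mathbb{D}\text{ holomorphic},\ f(z_1)=0,\ f(z_2)=\alpha\}.$$ For $z\in\Omega$ and $r>0$ let $B_{\Omega}^{c}(z,r)=\{\zeta\in\Omega:c_{\Omega}(z,\zeta)<r\}$. Fridman invariant (in complex dimension one, in the normalization using a supremum and $\tanh r$): $$h_{\Omega}^{c}(z):=\sup\left\{\tanh r : r>0,\ B_{\Omega}^{c}(z,r)\subseteq f(\mathbb{D})\text{ for some holomorphic embedding } f:\mathbb{D}\to\Omega\right\},$$ where a holomorphic embedding is an injective holomorphic map. *)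

theory Defs
  imports "HOL-Complex_Analysis.Complex_Analysis"
begin

(* A real supremum: for open connected S containing z1 and z2, the set contains 0 (take f = 0)
   and is bounded above (Schwarz-Pick along a chain of discs). *)
definition caratheodory_dist :: "complex set \<Rightarrow> complex \<Rightarrow> complex \<Rightarrow> real" where
  "caratheodory_dist S z1 z2 =
     Sup {artanh (cmod \<alpha>) | f \<alpha>. f holomorphic_on S \<and> f ` S \<subseteq> ball 0 1 \<and> f z1 = 0 \<and> f z2 = \<alpha>}"

definition caratheodory_ball :: "complex set \<Rightarrow> complex \<Rightarrow> real \<Rightarrow> complex set" where
  "caratheodory_ball S z r = {\<zeta> \<in> S. caratheodory_dist S z \<zeta> < r}"

definition holomorphic_embedding :: "(complex \<Rightarrow> complex) \<Rightarrow> complex set \<Rightarrow> complex set \<Rightarrow> bool" where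
  "holomorphic_embedding f U S \<longleftrightarrow> f holomorphic_on U \<and> inj_on f U \<and> f ` U \<subseteq> S"

(* The set is bounded above by 1, but it can be empty (e.g. S = UNIV, where the pseudodistance
   vanishes); then the real supremum is an unspecified value rather than 0. *)
definition fridman_invariant :: "complex set \<Rightarrow> complex \<Rightarrow> real" where
  "fridman_invariant S z =
     Sup {tanh r | r. r > 0 \<and>
       (\<exists>f. holomorphic_embedding f (ball 0 1) S \<and> caratheodory_ball S z r \<subseteq> f ` ball 0 1)}"

end

theory Submission
  imports Defs
begin

text \<open>
  Bounded holomorphic functions extend across the relatively discrete set \<open>A\<close>, so by Schwarz--Pick
  the Caratheodory distance of \<open>\<Omega> = \<D> - A\<close> is the restriction of that of the disc, and the balls
  around \<open>z\<close> are pseudohyperbolic discs with the points of \<open>A\<close> removed. If the radius is at most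
  the distance \<open>\<rho>\<close> from \<open>z\<close> to \<open>A\<close>, the ball is the conformal image of a disc. If it exceeds
  \<open>\<rho>\<close>, the ball contains small circles around some \<open>w \<in> A\<close>; these cannot lie in an image of the
  disc that avoids \<open>w\<close>, because such an image is simply connected.
\<close>

section \<open>Inverse hyperbolic tangent on (-1, 1)\<close>

lemma tanh_artanh_real:
  fixes x :: real
  assumes "\<bar>x\<bar> < 1"
  shows "tanh (artanh x) = x"
proof -
  let ?q = "(1 + x) / (1 - x)"
  have q: "?q > 0" using assms by (intro divide_pos_pos) linarith+
  \<comment> \<open>As \<open>artanh x\<close> is half the logarithm of \<open>?q\<close>, this
    supplies the exponential in the formula tanh y = (1 - exp (-2 y)) / (1 + exp (-2 y)).\<close>
  have "exp (- 2 * artanh x) = inverse ?q"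
    using q by (simp add: artanh_def exp_minus)
  then have "tanh (artanh x) = (1 - inverse ?q) / (1 + inverse ?q)"
    by (simp add: tanh_real_altdef)
  also have "\<dots> = x"
    using assms by (auto simp: field_simps abs_if split: if_splits)
  finally show ?thesis .
qed

lemma artanh_less_iff_less_tanh:
  fixes x r :: real
  assumes "\<bar>x\<bar> < 1"
  shows "artanh x < r \<longleftrightarrow> x < tanh r"
  by (metis assms tanh_artanh_real tanh_real_less_iff)

lemma artanh_real_mono:
  fixes x y :: real
  assumes "\<bar>x\<bar> < 1" "\<bar>y\<bar> < 1" "x \<le> y"
  shows "artanh x \<le> artanh y"
  by (metis assms tanh_artanh_real tanh_real_le_iff)

section \<open>Removable singularities\<close>

text \<open>Riemann's theorem applies at each point separately. The witness
  \<open>remove_sings f\<close> is one global function given by limits of \<open>f\<close>, so the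
  local extensions need no gluing. The bound is non-strict because it has to survive these
  limits.\<close>

lemma bounded_holomorphic_extends_sparse:
  assumes "open D" and sp: "X sparse_in D"
    and hol: "f holomorphic_on D - X"
    and bdd: "\<And>z. z \<in> D - X \<Longrightarrow> norm (f z) \<le> B"
  obtains g where "g holomorphic_on D" "\<And>z. z \<in> D - X \<Longrightarrow> g z = f z"
    "\<And>z. z \<in> D \<Longrightarrow> norm (g z) \<le> B"
proof
  have op: "open (D - X)" by (rule open_diff_sparse_pts[OF assms(1,2)])
  have loc: "remove_sings f analytic_on {z} \<and> norm (remove_sings f z) \<le> B" if z: "z \<in> D" for z
  proof -
    have "eventually (\<lambda>w. w \<in> D - X) (at z)"
    proof -
      have "eventually (\<lambda>w. w \<notin> X) (at z)"
        using sp z sparse_in_eventually_iff[OF \<open>open D\<close>] by blast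
      moreover have "eventually (\<lambda>w. w \<in> D) (at z)"
        using z \<open>open D\<close> eventually_at_in_open' by blast
      ultimately show ?thesis by eventually_elim auto
    qed
    then obtain r where r: "r > 0" "ball z r - {z} \<subseteq> D - X"
      unfolding eventually_at by (force simp: dist_commute)
    have hol': "f holomorphic_on ball z r - {z}"
      using hol r(2) by (rule holomorphic_on_subset)
    have ev: "eventually (\<lambda>w. norm (f w) \<le> B) (at z)"
      unfolding eventually_at using r bdd by (force simp: dist_commute)
    then have "\<exists>h. h holomorphic_on ball z r \<and> (\<forall>w\<in>ball z r - {z}. h w = f w)"
      using holomorphic_on_extend_bounded[OF hol'] r(1) by auto
    then obtain h where h: "h holomorphic_on ball z r" "\<And>w. w \<in> ball z r - {z} \<Longrightarrow> h w = f w"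
      by blast
    \<comment> \<open>A limit at \<open>w\<close> ignores the value \<open>f w\<close>, so the
      centre \<open>z\<close> is covered too, where \<open>f\<close> may be arbitrary.\<close>
    have lim: "f \<midarrow>w\<rightarrow> h w" if w: "w \<in> ball z r" for w
    proof -
      have "h analytic_on {w}"
        using h(1) w open_ball analytic_at by blast
      then have "h \<midarrow>w\<rightarrow> h w"
        using analytic_at_imp_isCont isContD by blast
      moreover have "eventually (\<lambda>u. h u = f u) (at w)"
      proof -
        have "eventually (\<lambda>u. u \<in> ball z r) (at w)"
          using w eventually_at_in_open' by blast
        moreover have "eventually (\<lambda>u. u \<noteq> z) (at w)"
          by (rule eventually_neq_at_within)
        ultimately show ?thesis by eventually_elim (use h(2) in auto)
      qed
      ultimately show ?thesis
        using tendsto_cong by blast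
    qed
    then have eq: "remove_sings f w = h w" if "w \<in> ball z r" for w
      using that by blast
    then have "remove_sings f holomorphic_on ball z r"
      using h(1) holomorphic_cong by metis
    moreover have zr: "z \<in> ball z r" using r(1) by simp
    ultimately have "remove_sings f analytic_on {z}"
      using analytic_at open_ball by blast
    moreover have "norm (h z) \<le> B"
      using Lim_norm_ubound[OF _ lim[OF zr] ev] by simp
    ultimately show ?thesis using eq[OF zr] by simp
  qed
  show "remove_sings f holomorphic_on D"
    using loc analytic_on_analytic_at analytic_imp_holomorphic by blast
  show "norm (remove_sings f z) \<le> B" if "z \<in> D" for z
    using loc[OF that] by blast
  show "remove_sings f z = f z" if "z \<in> D - X" for z
    using that hol op by (intro remove_sings_at_analytic) (auto simp: analytic_at)
qed

section \<open>The Caratheodory distance of a punctured disc\<close>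

lemma Schwarz_Pick_cball:
  assumes hol: "g holomorphic_on ball 0 1"
    and le: "\<And>u. u \<in> ball 0 1 \<Longrightarrow> norm (g u) \<le> 1"
    and z: "norm z < 1" "g z = 0" and \<zeta>: "norm \<zeta> < 1"
  shows "norm (g \<zeta>) \<le> norm (Moebius_function 0 z \<zeta>)"
proof -
  define \<xi> where "\<xi> = Moebius_function 0 z \<zeta>"
  have \<xi>: "norm \<xi> < 1" unfolding \<xi>_def by (intro Moebius_function_norm_lt_1 z \<zeta>)
  have inv: "Moebius_function 0 (-z) \<xi> = \<zeta>"
    unfolding \<xi>_def by (rule Moebius_function_compose) (use z \<zeta> in auto)
  have into: "Moebius_function 0 (-z) u \<in> ball 0 1" if "norm u < 1" for u
    using Moebius_function_norm_lt_1[of "-z" u] z that by simp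
  have hol': "(\<lambda>u. g (Moebius_function 0 (-z) u)) holomorphic_on ball 0 1"
    using holomorphic_on_compose_gen[OF Moebius_function_holomorphic[of "-z" 0] hol] z into
    by (simp add: o_def image_subset_iff)
  text \<open>The Schwarz lemma requires values in the open disc, hence the factor \<open>t < 1\<close>.\<close>
  have "t * norm (g \<zeta>) \<le> norm \<xi>" if t: "0 < t" "t < 1" for t :: real
  proof -
    let ?h = "\<lambda>u. of_real t * g (Moebius_function 0 (-z) u)"
    have "norm (?h \<xi>) \<le> norm \<xi>"
    proof (rule Schwarz_Lemma)
      show "?h holomorphic_on ball 0 1" by (intro holomorphic_intros hol')
      show "?h 0 = 0" using z by (simp add: Moebius_function_of_zero)
      fix u :: complex assume "norm u < 1"
      then have "t * norm (g (Moebius_function 0 (-z) u)) \<le> t * 1"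
        using le into t by (intro mult_left_mono) auto
      then have "t * norm (g (Moebius_function 0 (-z) u)) < 1" using t by linarith
      then show "norm (?h u) < 1" using t by (simp add: norm_mult)
    qed (rule \<xi>)
    then show ?thesis using t inv by (simp add: norm_mult)
  qed
  \<comment> \<open>Let \<open>t\<close> tend to 1.\<close>
  then show ?thesis unfolding \<xi>_def[symmetric]
    by (rule field_le_mult_one_interval)
qed

text \<open>The Moebius map itself is an admissible competitor, and every other one extends to the
  disc and obeys Schwarz-Pick. The supremum is thus a maximum, which also settles nonemptiness and
  boundedness.\<close>

lemma caratheodory_dist_disc_minus_sparse:
  assumes sp: "X sparse_in ball 0 1"
    and z: "z \<in> ball 0 1 - X" and \<zeta>: "\<zeta> \<in> ball 0 1 - X"
  shows "caratheodory_dist (ball 0 1 - X) z \<zeta> = artanh (norm (Moebius_function 0 z \<zeta>))"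
  unfolding caratheodory_dist_def
proof (rule cSup_eq_maximum)
  let ?M = "Moebius_function 0 z"
  have "?M holomorphic_on ball 0 1 - X"
    using z by (intro holomorphic_on_subset[OF Moebius_function_holomorphic]) auto
  moreover have "?M ` (ball 0 1 - X) \<subseteq> ball 0 1"
    using z by (auto intro: Moebius_function_norm_lt_1)
  ultimately show "artanh (norm (?M \<zeta>)) \<in> {artanh (cmod \<alpha>) | f \<alpha>.
      f holomorphic_on ball 0 1 - X \<and> f ` (ball 0 1 - X) \<subseteq> ball 0 1 \<and> f z = 0 \<and> f \<zeta> = \<alpha>}"
    using Moebius_function_eq_zero by blast
next
  fix y assume "y \<in> {artanh (cmod \<alpha>) | f \<alpha>.
      f holomorphic_on ball 0 1 - X \<and> f ` (ball 0 1 - X) \<subseteq> ball 0 1 \<and> f z = 0 \<and> f \<zeta> = \<alpha>}"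
  then obtain f where f: "f holomorphic_on ball 0 1 - X" "f ` (ball 0 1 - X) \<subseteq> ball 0 1"
    "f z = 0" "y = artanh (norm (f \<zeta>))" by blast
  have "norm (f u) \<le> 1" if "u \<in> ball 0 1 - X" for u
    using f(2) that by (force simp: image_subset_iff)
  then obtain g where g: "g holomorphic_on ball 0 1" "\<And>u. u \<in> ball 0 1 - X \<Longrightarrow> g u = f u"
    "\<And>u. u \<in> ball 0 1 \<Longrightarrow> norm (g u) \<le> 1"
    using bounded_holomorphic_extends_sparse[OF open_ball sp f(1)] by blast
  have "norm (g \<zeta>) \<le> norm (Moebius_function 0 z \<zeta>)"
    using z \<zeta> f(3) g by (intro Schwarz_Pick_cball) auto
  moreover have "norm (Moebius_function 0 z \<zeta>) < 1"
    using z \<zeta> by (auto intro: Moebius_function_norm_lt_1)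
  ultimately show "y \<le> artanh (norm (Moebius_function 0 z \<zeta>))"
    unfolding f(4) using g(2)[OF \<zeta>] by (intro artanh_real_mono) auto
qed

lemma caratheodory_ball_disc_minus_sparse:
  assumes "X sparse_in ball 0 1" "z \<in> ball 0 1 - X"
  shows "caratheodory_ball (ball 0 1 - X) z r
           = {\<zeta> \<in> ball 0 1 - X. norm (Moebius_function 0 z \<zeta>) < tanh r}"
proof -
  have "caratheodory_dist (ball 0 1 - X) z \<zeta> < r \<longleftrightarrow> norm (Moebius_function 0 z \<zeta>) < tanh r"
    if "\<zeta> \<in> ball 0 1 - X" for \<zeta>
    using that assms Moebius_function_norm_lt_1[of z \<zeta> 0]
    by (simp add: caratheodory_dist_disc_minus_sparse artanh_less_iff_less_tanh)
  then show ?thesis unfolding caratheodory_ball_def by blast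
qed

section \<open>Embedded discs\<close>

text \<open>A small circle around \<open>w\<close> has winding number 1 about \<open>w\<close>,
  whereas a loop in a simply connected set has winding number 0 about every omitted point.\<close>

lemma punctured_nhd_in_simply_connected:
  fixes U :: "complex set"
  assumes "simply_connected U" and "eventually (\<lambda>u. u \<in> U) (at w)"
  shows "w \<in> U"
proof (rule ccontr)
  assume w: "w \<notin> U"
  obtain e where e: "e > 0" "\<And>u. u \<noteq> w \<Longrightarrow> dist u w < e \<Longrightarrow> u \<in> U"
    using assms(2) unfolding eventually_at by blast
  have "path_image (circlepath w (e/2)) \<subseteq> U"
    using e by (auto simp: dist_commute)
  then have "winding_number (circlepath w (e/2)) w = 0"
    by (intro simply_connected_imp_winding_number_zero[OF assms(1) _ _ _ w]) auto
  then show False using winding_number_circlepath_centre[of "e/2" w] e(1) by simp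
qed

text \<open>By invariance of domain, an injective continuous map on the open disc is a homeomorphism
  onto its image.\<close>

lemma simply_connected_embedded_disc:
  assumes "holomorphic_embedding f (ball 0 1) S"
  shows "simply_connected (f ` ball 0 1)"
proof -
  have "(ball 0 1 :: complex set) homeomorphic f ` ball 0 1"
    using assms invariance_of_domain_homeomorphic[of "ball 0 1" f]
    by (auto simp: holomorphic_embedding_def holomorphic_on_imp_continuous_on)
  then show ?thesis
    using homeomorphic_simply_connected convex_imp_simply_connected convex_ball by blast
qed

text \<open>The embedding shrinks the unit disc to radius \<open>\<rho>\<close> and then applies
  \<open>Moebius_function 0 (-z)\<close>, the inverse of
  \<open>Moebius_function 0 z\<close>.\<close>

lemma pseudohyperbolic_disc_embedding:
  assumes z: "norm z < 1" and \<rho>: "0 < \<rho>" "\<rho> < 1"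
    and sub: "{\<zeta> \<in> ball 0 1. norm (Moebius_function 0 z \<zeta>) < \<rho>} \<subseteq> S"
  obtains f where "holomorphic_embedding f (ball 0 1) S"
    "{\<zeta> \<in> ball 0 1. norm (Moebius_function 0 z \<zeta>) < \<rho>} \<subseteq> f ` ball 0 1"
proof
  let ?f = "\<lambda>u. Moebius_function 0 (-z) (of_real \<rho> * u)"
  have lt: "norm (of_real \<rho> * u) < \<rho>" if "norm u < 1" for u :: complex
    using that \<rho> by (simp add: norm_mult)
  have lt1: "norm (of_real \<rho> * u) < 1" if "norm u < 1" for u :: complex
    using lt[OF that] \<rho> by linarith
  have inv: "Moebius_function 0 z (?f u) = of_real \<rho> * u" if "norm u < 1" for u
    by (rule Moebius_function_compose) (use z lt1[OF that] in auto)
  have "(\<lambda>u. of_real \<rho> * u) holomorphic_on ball 0 1"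
    by (intro holomorphic_intros)
  then have "?f holomorphic_on ball 0 1"
    using holomorphic_on_compose_gen[OF _ Moebius_function_holomorphic[of "-z" 0],
        of "\<lambda>u. of_real \<rho> * u" "ball 0 1"] z lt1
    by (simp add: o_def image_subset_iff)
  moreover have "inj_on ?f (ball 0 1)"
  proof (rule inj_onI)
    fix u v assume "u \<in> ball 0 1" "v \<in> ball 0 1" "?f u = ?f v"
    then have "of_real \<rho> * u = of_real \<rho> * v" by (metis inv mem_ball_0)
    then show "u = v" using \<rho> by auto
  qed
  moreover have "?f ` ball 0 1 \<subseteq> S"
  proof (rule image_subsetI)
    fix u :: complex assume "u \<in> ball 0 1"
    then have u: "norm u < 1" by simp
    show "?f u \<in> S"
      using sub inv[OF u] lt[OF u] Moebius_function_norm_lt_1[OF _ lt1[OF u], of "-z" 0] z by auto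
  qed
  ultimately show "holomorphic_embedding ?f (ball 0 1) S"
    by (simp add: holomorphic_embedding_def)
  show "{\<zeta> \<in> ball 0 1. norm (Moebius_function 0 z \<zeta>) < \<rho>} \<subseteq> ?f ` ball 0 1"
  proof
    fix \<zeta> assume \<zeta>: "\<zeta> \<in> {\<zeta> \<in> ball 0 1. norm (Moebius_function 0 z \<zeta>) < \<rho>}"
    let ?u = "Moebius_function 0 z \<zeta> / of_real \<rho>"
    have "?f ?u = \<zeta>"
      using Moebius_function_compose[of "-z" z \<zeta>] z \<zeta> \<rho> by simp
    moreover have "?u \<in> ball 0 1"
      using \<zeta> \<rho> by (simp add: norm_divide)
    ultimately show "\<zeta> \<in> ?f ` ball 0 1" by (metis image_eqI)
  qed
qed

section \<open>The Fridman invariant\<close>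

lemma fridman_invariant_disc_minus_sparse:
  assumes sp: "X sparse_in ball 0 1" and X: "X \<noteq> {}" "X \<subseteq> ball 0 1"
    and z: "z \<in> ball 0 1 - X"
  shows "fridman_invariant (ball 0 1 - X) z = (INF w\<in>X. norm (Moebius_function 0 z w))"
    (is "_ = ?\<rho>")
  unfolding fridman_invariant_def
proof (rule cSup_eq_maximum)
  let ?M = "Moebius_function 0 z"
  have z1: "norm z < 1" using z by simp
  have \<rho>_le: "?\<rho> \<le> norm (?M w)" if "w \<in> X" for w
    using that by (intro cINF_lower bdd_belowI2[of _ 0]) auto
  obtain w0 where w0: "w0 \<in> X" using X by blast
  have \<rho>1: "?\<rho> < 1"
    using \<rho>_le[OF w0] Moebius_function_norm_lt_1[OF z1, of w0 0] X w0 by force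
  \<comment> \<open>Positivity makes \<open>artanh ?\<rho>\<close> an admissible radius. It holds
    because a sparse set is relatively closed, so the points of \<open>X\<close> keep a Euclidean
    distance \<open>e\<close> from \<open>z\<close>, and the denominators of the Moebius values have
    modulus at most 2.\<close>
  have \<rho>0: "?\<rho> > 0"
  proof -
    obtain e where e: "e > 0" "ball z e \<subseteq> ball 0 1 - X"
      using open_diff_sparse_pts[OF open_ball sp] z open_contains_ball by blast
    have "e / 2 \<le> norm (?M w)" if w: "w \<in> X" for w
    proof -
      have w1: "norm w < 1" using X w by auto
      have "norm (cnj z * w) < 1"
        using norm_mult_less[of "cnj z" 1 w 1] z1 w1 by simp
      then have "norm (1 - cnj z * w) \<le> 2" "1 - cnj z * w \<noteq> 0"
        using norm_triangle_ineq4[of 1 "cnj z * w"] by auto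
      moreover have "e \<le> norm (w - z)"
        using e w by (metis DiffE dist_norm dist_commute mem_ball not_le subsetD)
      ultimately show ?thesis
        using e(1) unfolding Moebius_function_simple norm_divide by (intro frac_le) auto
    qed
    then have "e / 2 \<le> ?\<rho>" using X by (intro cINF_greatest) auto
    then show ?thesis using e(1) by linarith
  qed
  {
    \<comment> \<open>The supremum is attained at the radius \<open>artanh ?\<rho>\<close>: the
      strict inequality keeps this disc free of \<open>X\<close>, even if some point of
      \<open>X\<close> realizes the infimum.\<close>
    have "{\<zeta> \<in> ball 0 1. norm (?M \<zeta>) < ?\<rho>} \<subseteq> ball 0 1 - X"
      using \<rho>_le by force
    then obtain f where "holomorphic_embedding f (ball 0 1) (ball 0 1 - X)"
      "{\<zeta> \<in> ball 0 1. norm (?M \<zeta>) < ?\<rho>} \<subseteq> f ` ball 0 1"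
      using pseudohyperbolic_disc_embedding[OF z1 \<rho>0 \<rho>1] by blast
    moreover have th: "tanh (artanh ?\<rho>) = ?\<rho>" using \<rho>0 \<rho>1 by (intro tanh_artanh_real) auto
    ultimately have "caratheodory_ball (ball 0 1 - X) z (artanh ?\<rho>) \<subseteq> f ` ball 0 1"
      unfolding caratheodory_ball_disc_minus_sparse[OF sp z] by auto
    moreover have "artanh ?\<rho> > 0"
      using th \<rho>0 by (metis tanh_real_pos_iff)
    ultimately show "?\<rho> \<in> {tanh r | r. r > 0 \<and>
       (\<exists>f. holomorphic_embedding f (ball 0 1) (ball 0 1 - X) \<and>
            caratheodory_ball (ball 0 1 - X) z r \<subseteq> f ` ball 0 1)}"
      using th \<open>holomorphic_embedding f _ _\<close>
      by (intro CollectI exI[of _ "artanh ?\<rho>"] exI[of _ f] conjI) simp_all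
  }
  fix y assume "y \<in> {tanh r | r. r > 0 \<and>
       (\<exists>f. holomorphic_embedding f (ball 0 1) (ball 0 1 - X) \<and>
            caratheodory_ball (ball 0 1 - X) z r \<subseteq> f ` ball 0 1)}"
  then obtain r f where y: "y = tanh r" and f: "holomorphic_embedding f (ball 0 1) (ball 0 1 - X)"
    and sub: "caratheodory_ball (ball 0 1 - X) z r \<subseteq> f ` ball 0 1" by blast
  have "y \<le> norm (?M w)" if w: "w \<in> X" for w
  proof (rule ccontr)
    assume less: "\<not> y \<le> norm (?M w)"
    have wb: "w \<in> ball 0 1" using X w by blast
    \<comment> \<open>By continuity of \<open>?M\<close> at \<open>w\<close> and sparseness of
      \<open>X\<close>, a punctured neighbourhood of \<open>w\<close> lies in the Caratheodory ball,
      hence in the image of \<open>f\<close>. Simple connectedness then forces \<open>w\<close> into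
      that image, which avoids \<open>X\<close>.\<close>
    have "?M analytic_on {w}"
      using Moebius_function_holomorphic[OF z1] wb analytic_at open_ball by blast
    then have "((\<lambda>u. norm (?M u)) \<longlongrightarrow> norm (?M w)) (at w)"
      using analytic_at_imp_isCont isContD tendsto_norm by blast
    then have "eventually (\<lambda>u. norm (?M u) < tanh r) (at w)"
      using less y by (intro order_tendstoD(2)) auto
    moreover have "eventually (\<lambda>u. u \<notin> X) (at w)"
      using sp wb sparse_in_eventually_iff[OF open_ball] by blast
    moreover have "eventually (\<lambda>u. u \<in> ball 0 1) (at w)"
      using wb eventually_at_in_open' by blast
    ultimately have "eventually (\<lambda>u. u \<in> f ` ball 0 1) (at w)"
    proof eventually_elim
      case (elim u)
      then show ?case
        using sub unfolding caratheodory_ball_disc_minus_sparse[OF sp z] by blast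
    qed
    then have "w \<in> f ` ball 0 1"
      by (rule punctured_nhd_in_simply_connected[OF simply_connected_embedded_disc[OF f]])
    then show False using f w by (auto simp: holomorphic_embedding_def)
  qed
  then show "y \<le> ?\<rho>" using X by (intro cINF_greatest) auto
qed

theorem theorem1p4:
  fixes a :: "nat \<Rightarrow> complex" and p z :: complex
  assumes "\<And>n. a n \<in> ball 0 1"
    and "a \<longlonglongrightarrow> p"
    and "p \<in> frontier (ball 0 1)"
    and "z \<in> ball 0 1 - range a"
  shows "fridman_invariant (ball 0 1 - range a) z
           = (INF w\<in>range a. cmod ((w - z) / (1 - cnj z * w)))"
proof -
  have "p \<notin> ball 0 1" using assms(3) by simp
  \<comment> \<open>The range of a convergent sequence has no limit point other than its limit, and
    \<open>p\<close> lies outside the open disc.\<close>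
  then have "range a sparse_in ball 0 1"
    using sequence_unique_limpt[OF assms(2)] by (auto simp: sparse_in_open)
  then show ?thesis
    using fridman_invariant_disc_minus_sparse[of "range a" z] assms(1,4)
    by (simp add: image_subset_iff Moebius_function_simple)
qed

end
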